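(* Let $g$ be a continuous function on $\overline{\mathbb{D}}$ (with values in $\mathbb{C}$) whose restriction to $\mathbb{D}$ is holomorphic. Let $\sum_{n\in\mathbb{N}} a_nz^n$ be the power series expansion of $g$ in a neighbourhood of $0$. Suppose there exists a function $h$ that is holomorphic in a neighbourhood of $\overline{\mathbb{D}(1,1)^{1/2}}\subset\mathbb{C}$ such that $$\forall z\in\overline{\mathbb{D}},\quad g(z)=h(\sqrt{1-z}).$$ Then there exist a unique sequence of constants $(c_l)_{l\geq1}$ and a constant $C$ such that for any positive integer $K$, as $n\to\infty$, $$a_n=\frac{1}{n^{3/2}}\left(C+\frac{c_1}{n}+\dots+\frac{c_K}{n^K}+O\left(\frac{1}{n^{K+1}}\right)\right).$$ Moreover $C=-\dfrac{h'(0)}{2\sqrt{\pi}}$.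
   Context: $\mathbb{D}=\{z\in\mathbb{C}:|z|<1\}$ and $\mathbb{D}(1,1)=\{\omega\in\mathbb{C}:|\omega-1|<1\}$. The square root $\sqrt{w}=w^{1/2}$ is the principal one, $w^{1/2}=\exp(\tfrac12 L(w))$ with $L$ the principal logarithm on $\mathbb{C}\setminus]-\infty,0]$, extended continuously by $\sqrt0=0$. $\mathbb{D}(1,1)^{1/2}=\{\omega^{1/2}:|\omega-1|<1\}$ and $\overline{\mathbb{D}(1,1)^{1/2}}$ is its closure in $\mathbb{C}$. *)

theory Defs
  imports "HOL-Complex_Analysis.Complex_Analysis" "HOL-Library.Landau_Symbols"
begin

text \<open>
  The sequence \<open>(c\<^sub>l)\<close> is indexed by \<open>l \<ge> 1\<close>, so the value \<open>c 0\<close> is irrelevant.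
  The function \<open>\<epsilon>\<close>, which may depend on \<open>K\<close>, is the \<open>O(1/n\<^sup>K\<^sup>+\<^sup>1)\<close> term.
\<close>

definition has_three_halves_expansion ::
    "(nat \<Rightarrow> complex) \<Rightarrow> complex \<Rightarrow> (nat \<Rightarrow> complex) \<Rightarrow> bool" where
  "has_three_halves_expansion a C c \<longleftrightarrow>
     (\<forall>K\<ge>1. \<exists>\<epsilon> :: nat \<Rightarrow> complex.
        \<epsilon> \<in> O(\<lambda>n. 1 / of_nat n ^ (K + 1)) \<and>
        (\<forall>n\<ge>1. a n = 1 / of_real (real n powr (3 / 2)) *
                  (C + (\<Sum>l = 1..K. c l / of_nat n ^ l) + \<epsilon> n)))"

end

theory Submission
  imports Defs
begin

text \<open>
  Write \<open>h w = (\<Sum>j<2 * M. d j * w ^ j) + w ^ (2 * M) * H w\<close> and put \<open>w = csqrt (1 - z)\<close>.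
  The last term has a bounded \<open>M\<close>-th derivative in the unit disc, so its coefficients are \<open>O(1 / n\<^sup>M)\<close>
  by Cauchy's inequality. The even powers of \<open>w\<close> are polynomials in \<open>z\<close>, and the odd ones have
  explicit binomial coefficients, whose expansion in powers of \<open>1 / n\<close> follows from their first order
  recurrence; the leading constant \<open>1 / \<Gamma>(- 1 / 2)\<close> is contributed by \<open>j = 1\<close> alone.
\<close>

section \<open>The square root on the unit disc around 1\<close>

lemma csqrt_one_minus_has_field_derivative:
  assumes "z \<in> ball 0 1"
  shows "((\<lambda>z. csqrt (1 - z)) has_field_derivative - 1 / (2 * csqrt (1 - z))) (at z)"
proof -
  have "\<bar>Re z\<bar> < 1"
    using assms abs_Re_le_cmod[of z] by simp
  hence "1 - z \<notin> \<real>\<^sub>\<le>\<^sub>0"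
    by (auto simp: complex_nonpos_Reals_iff)
  thus ?thesis
    by (auto intro!: derivative_eq_intros simp: field_simps)
qed

lemma one_minus_in_ball: "(1 - z \<in> ball 1 1) = (z \<in> ball 0 1)" for z :: complex
  by (simp add: dist_norm)

lemma csqrt_one_minus_in_closure:
  assumes "z \<in> ball 0 1"
  shows "csqrt (1 - z) \<in> closure (csqrt ` ball 1 1)"
  using assms one_minus_in_ball closure_subset by blast

lemma compact_closure_csqrt_ball: "compact (closure (csqrt ` ball 1 1))"
proof -
  have "norm w \<le> 2" if w: "w \<in> csqrt ` ball 1 1" for w
  proof -
    obtain v where v: "w = csqrt v" "norm (1 - v) < 1"
      using w by (auto simp: dist_norm)
    have "norm v \<le> 2"
      using v(2) norm_triangle_ineq2[of v 1] by (simp add: norm_minus_commute)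
    moreover have "norm w ^ 2 = norm v"
      by (simp add: v flip: norm_power)
    ultimately have "norm w ^ 2 \<le> 2 ^ 2" by simp
    thus ?thesis by (rule power2_le_imp_le) simp
  qed
  hence "bounded (csqrt ` ball 1 1)"
    unfolding bounded_iff by blast
  thus ?thesis by (simp add: compact_closure)
qed

section \<open>Coefficient bounds for the Taylor remainder\<close>

text \<open>Nothing is known about \<open>f\<close> on the unit circle, so Cauchy's inequality is
  applied on circles of radius \<open>\<rho> < 1\<close>; letting \<open>\<rho>\<close> tend to 1
  removes the factor \<open>1 / \<rho> ^ n\<close>.\<close>

lemma fps_coeff_bounded:
  fixes f :: "complex \<Rightarrow> complex"
  assumes holo: "f holomorphic_on ball 0 1" and bound: "\<And>z. z \<in> ball 0 1 \<Longrightarrow> norm (f z) \<le> B"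
    and F: "f has_fps_expansion F"
  shows "norm (fps_nth F n) \<le> B"
proof -
  have "norm (fps_nth F n) \<le> B / \<rho> ^ n" if "0 < \<rho>" "\<rho> < 1" for \<rho>
  proof -
    have sub: "ball 0 \<rho> \<subseteq> ball (0::complex) 1" "cball 0 \<rho> \<subseteq> ball (0::complex) 1"
      using that by auto
    have "norm ((deriv ^^ n) f 0) \<le> fact n * B / \<rho> ^ n"
      using that sub by (intro Cauchy_inequality bound holomorphic_on_subset[OF holo]
          holomorphic_on_imp_continuous_on[OF holomorphic_on_subset[OF holo]]) auto
    moreover have "norm (fps_nth F n) = norm ((deriv ^^ n) f 0) / fact n"
      using F by (simp add: fps_nth_fps_expansion norm_divide)
    ultimately show ?thesis
      by (simp add: divide_le_eq mult.commute)
  qed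
  hence "eventually (\<lambda>\<rho>. norm (fps_nth F n) \<le> B / \<rho> ^ n) (at_left 1)"
    by (intro eventually_at_leftI[of 0]) auto
  moreover have "((\<lambda>\<rho>. B / \<rho> ^ n) \<longlongrightarrow> B / 1 ^ n) (at_left 1)"
    by (intro tendsto_intros) auto
  ultimately show ?thesis
    using tendsto_lowerbound[of "\<lambda>\<rho>. B / \<rho> ^ n" "B / 1 ^ n" "at_left (1::real)"] by simp
qed

text \<open>
  Since \<open>w = csqrt (1 - z)\<close> satisfies \<open>dw/dz = - 1 / (2w)\<close>, one derivative in \<open>z\<close> costs two
  powers of \<open>w\<close>, so \<open>M\<close> derivatives of \<open>w\<^sup>2\<^sup>M H w\<close> remain bounded on the disc.
\<close>

lemma csqrt_remainder_coeff_bound: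
  assumes U: "open U" "closure (csqrt ` ball 1 1) \<subseteq> U" and H: "H holomorphic_on U"
    and F: "(\<lambda>z. csqrt (1 - z) ^ (2 * M) * H (csqrt (1 - z))) has_fps_expansion F"
  shows "\<exists>B. \<forall>n. norm (fps_nth F n) * real (n + 1) ^ M \<le> B"
  using H F
proof (induction M arbitrary: H F)
  case 0
  have inU: "csqrt (1 - z) \<in> U" if "z \<in> ball 0 1" for z
    using csqrt_one_minus_in_closure[OF that] U by blast
  have "compact (H ` closure (csqrt ` ball 1 1))"
    by (intro compact_continuous_image compact_closure_csqrt_ball
        continuous_on_subset[OF holomorphic_on_imp_continuous_on[OF 0(1)] U(2)])
  then obtain B where B: "\<And>w. w \<in> closure (csqrt ` ball 1 1) \<Longrightarrow> norm (H w) \<le> B"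
    unfolding bounded_iff by (meson bounded_iff compact_imp_bounded imageI)
  have "(\<lambda>z. H (csqrt (1 - z))) holomorphic_on ball 0 1"
    using holomorphic_on_compose_gen[of "\<lambda>z. csqrt (1 - z)" "ball 0 1" H U] inU 0(1)
      csqrt_one_minus_has_field_derivative
    by (force simp: o_def holomorphic_on_open)
  moreover have "(\<lambda>z. H (csqrt (1 - z))) has_fps_expansion F"
    using 0(2) by simp
  ultimately have "norm (fps_nth F n) \<le> B" for n
    using B csqrt_one_minus_in_closure by (intro fps_coeff_bounded) auto
  thus ?case by auto
next
  case (Suc M)
  \<comment> \<open>This is what remains of
    \<open>((2M + 2) w^(2M+1) H w + w^(2M+2) deriv H w) * (- 1 / (2 w))\<close> after the factor
    \<open>w^(2M)\<close> is taken out. The induction hypothesis is applied to \<open>H'\<close>,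
    hence the generalisation over \<open>H\<close>.\<close>
  define H' where "H' w = - of_nat (M + 1) * H w - w * deriv H w / 2" for w
  have H': "H' holomorphic_on U"
    unfolding H'_def using Suc.prems(1) U(1) by (intro holomorphic_intros) auto
  let ?f = "\<lambda>M H z. csqrt (1 - z) ^ (2 * M) * H (csqrt (1 - z))"
  have D: "(?f (Suc M) H has_field_derivative ?f M H' z) (at z)" if z: "z \<in> ball 0 1" for z
  proof -
    let ?s = "csqrt (1 - z)"
    have inU: "?s \<in> U"
      using csqrt_one_minus_in_closure[OF z] U by blast
    have nz: "?s \<noteq> 0" using z by auto
    have dH: "(H has_field_derivative deriv H ?s) (at ?s)"
      using Suc.prems(1) U(1) inU by (meson holomorphic_derivI)
    have "((\<lambda>w. w ^ (2 * Suc M) * H w) has_field_derivative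
            (of_nat (2 * Suc M) * ?s ^ (2 * M + 1) * H ?s + ?s ^ (2 * Suc M) * deriv H ?s)) (at ?s)"
    proof -
      have "((\<lambda>w. w ^ Suc n) has_field_derivative of_nat (Suc n) * ?s ^ n) (at ?s)" for n
        by (rule derivative_eq_intros refl)+ simp
      from DERIV_mult[OF this[of "2 * M + 1"] dH] show ?thesis
        by (simp add: algebra_simps)
    qed
    from DERIV_chain2[OF this csqrt_one_minus_has_field_derivative[OF z]]
    have "(?f (Suc M) H has_field_derivative
        (of_nat (2 * Suc M) * ?s ^ (2 * M + 1) * H ?s + ?s ^ (2 * Suc M) * deriv H ?s)
          * (- 1 / (2 * ?s))) (at z)" .
    moreover have "(of_nat (2 * Suc M) * ?s ^ (2 * M + 1) * H ?s + ?s ^ (2 * Suc M) * deriv H ?s)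
          * (- 1 / (2 * ?s)) = ?s ^ (2 * M) * H' ?s"
      using nz unfolding H'_def by (simp add: field_simps)
    ultimately show ?thesis by (simp del: power_Suc mult_Suc_right)
  qed
  have "deriv (?f (Suc M) H) has_fps_expansion fps_deriv F"
    using Suc.prems(2) by (rule has_fps_expansion_deriv)
  moreover have "eventually (\<lambda>z. deriv (?f (Suc M) H) z = ?f M H' z) (nhds 0)"
    using D by (intro eventually_nhds_in_open[THEN eventually_mono, of "ball 0 1"])
      (auto intro: DERIV_imp_deriv)
  ultimately have "?f M H' has_fps_expansion fps_deriv F"
    by (simp only: has_fps_expansion_cong[OF _ refl])
  from Suc.IH[OF H' this] obtain B where
    B: "\<And>n. norm (of_nat (n + 1) * fps_nth F (n + 1)) * real (n + 1) ^ M \<le> B" by auto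
  \<comment> \<open>The derivative says nothing about the constant coefficient, hence the maximum.
    For \<open>n = m + 1\<close>, the estimate \<open>n + 1 \<le> 2 * (m + 1)\<close> produces the
    factor \<open>2 ^ Suc M\<close>.\<close>
  have "norm (fps_nth F n) * real (n + 1) ^ Suc M \<le> max (norm (fps_nth F 0)) (2 ^ Suc M * B)" for n
  proof (cases n)
    case (Suc m)
    have "norm (fps_nth F n) * real (n + 1) ^ Suc M \<le>
        norm (fps_nth F (m + 1)) * (2 * real (m + 1)) ^ Suc M"
      using Suc by (intro mult_mono power_mono) auto
    also have "\<dots> = 2 ^ Suc M * (norm (of_nat (m + 1) * fps_nth F (m + 1)) * real (m + 1) ^ M)"
      by (simp add: power_mult_distrib norm_mult del: of_nat_Suc of_nat_add)
    also have "\<dots> \<le> 2 ^ Suc M * B"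
      using B[of m] by (intro mult_left_mono) auto
    finally show ?thesis by simp
  qed auto
  thus ?case by blast
qed

section \<open>Taylor expansion at 0 with holomorphic remainder\<close>

text \<open>The difference quotient has a removable singularity at 0, filled by the derivative. The
  quotient is a total function, so the equation holds for all \<open>w\<close>, also outside
  \<open>U\<close>.\<close>

lemma holomorphic_divide_out_at_0:
  fixes f :: "complex \<Rightarrow> complex"
  assumes "f holomorphic_on U" "open U"
  obtains q where "q holomorphic_on U" "q 0 = deriv f 0" "\<And>w. f w = f 0 + w * q w"
proof
  show "(\<lambda>w. if w = 0 then deriv f 0 else (f w - f 0) / (w - 0)) holomorphic_on U"
    using assms by (rule pole_lemma_open)
qed auto

text \<open>Each step divides one more factor \<open>w\<close> out of the remainder. The base case
  already divides twice, so that \<open>d 1\<close> occurs in every sum; it is the only coefficient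
  identified, because the constant \<open>C\<close> depends on it alone.\<close>

lemma holomorphic_taylor_remainder_at_0:
  fixes h :: "complex \<Rightarrow> complex"
  assumes "h holomorphic_on U" "open U"
  shows "\<exists>d H. d 1 = deriv h 0 \<and> H holomorphic_on U \<and>
           (\<forall>w. h w = (\<Sum>j<m + 2. d j * w ^ j) + w ^ (m + 2) * H w)"
proof (induction m)
  case 0
  obtain q where q: "q holomorphic_on U" "q 0 = deriv h 0" "\<And>w. h w = h 0 + w * q w"
    using holomorphic_divide_out_at_0[OF assms] by blast
  obtain q' where q': "q' holomorphic_on U" "q' 0 = deriv q 0" "\<And>w. q w = q 0 + w * q' w"
    using holomorphic_divide_out_at_0[OF q(1) assms(2)] by blast
  show ?case
  proof (intro exI[of _ "\<lambda>j::nat. if j = 0 then h 0 else deriv h 0"] exI[of _ q'] conjI allI)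
    fix w
    have "h w = h 0 + w * (q 0 + w * q' w)" using q(3) q'(3) by metis
    thus "h w = (\<Sum>j<0 + 2. (if j = 0 then h 0 else deriv h 0) * w ^ j) + w ^ (0 + 2) * q' w"
      using q(2) by (simp add: numeral_2_eq_2 algebra_simps)
  qed (use q'(1) in auto)
next
  case (Suc m)
  then obtain d H where dH: "d 1 = deriv h 0" "H holomorphic_on U"
    "\<And>w. h w = (\<Sum>j<m + 2. d j * w ^ j) + w ^ (m + 2) * H w" by blast
  obtain q where q: "q holomorphic_on U" "\<And>w. H w = H 0 + w * q w"
    using holomorphic_divide_out_at_0[OF dH(2) assms(2)] by metis
  show ?case
  proof (intro exI[of _ "d(m + 2 := H 0)"] exI[of _ q] conjI allI)
    fix w
    have "h w = (\<Sum>j<m + 2. d j * w ^ j) + w ^ (m + 2) * (H 0 + w * q w)"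
      using dH(3) q(2) by metis
    also have "(\<Sum>j<m + 2. d j * w ^ j) = (\<Sum>j<m + 2. (d(m + 2 := H 0)) j * w ^ j)"
      by (intro sum.cong) auto
    finally show "h w = (\<Sum>j<Suc m + 2. (d(m + 2 := H 0)) j * w ^ j) + w ^ (Suc m + 2) * q w"
      by (simp add: algebra_simps)
  qed (use dH(1) q(1) in auto)
qed

section \<open>Expansions in inverse powers\<close>

lemma tendsto_poly_inverse_nat:
  fixes p :: "complex poly"
  shows "(\<lambda>n. poly p (1 / of_nat n)) \<longlonglongrightarrow> coeff p 0"
proof -
  have "(\<lambda>n. poly p (1 / of_nat n)) \<longlonglongrightarrow> poly p 0"
    by (intro tendsto_poly lim_1_over_n)
  thus ?thesis by (simp add: poly_0_coeff_0)
qed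

lemma poly_inverse_nat_bigo_1:
  fixes p :: "complex poly"
  shows "(\<lambda>n. poly p (1 / of_nat n)) \<in> O(\<lambda>_. 1)"
proof -
  have "Bseq (\<lambda>n. poly p (1 / of_nat n))"
    using tendsto_poly_inverse_nat convergentI convergent_imp_Bseq by blast
  then obtain B where "\<And>n. norm (poly p (1 / of_nat n)) \<le> B"
    unfolding Bseq_def by blast
  thus ?thesis by (intro bigoI[of _ B]) auto
qed

lemma inverse_nat_power_bigo:
  "m \<le> k \<Longrightarrow> (\<lambda>n. 1 / of_nat n ^ k :: complex) \<in> O(\<lambda>n. 1 / of_nat n ^ m :: complex)"
  using power_increasing[of m k "real _"]
  by (intro bigoI[of _ 1] eventually_at_top_linorderI[of 1])
    (simp add: norm_divide norm_power frac_le)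

text \<open>The constant coefficient is the limit of the values, hence 0. Multiplying by
  \<open>n\<close> then removes one factor \<open>1 / n\<close> from both sides, and the argument
  repeats. All uniqueness of coefficients below rests on this.\<close>

lemma poly_inverse_nat_bigo_imp_coeff_eq_0:
  fixes p :: "complex poly"
  assumes "(\<lambda>n. poly p (1 / of_nat n)) \<in> O(\<lambda>n. 1 / of_nat n ^ K)" "i < K"
  shows "coeff p i = 0"
  using assms
proof (induction K arbitrary: p i)
  case (Suc K)
  obtain a q where p: "p = pCons a q" by (cases p)
  have "(\<lambda>n. 1 / of_nat n ^ Suc K :: complex) \<in> O(\<lambda>n. 1 / of_nat n ^ 1)"
    by (rule inverse_nat_power_bigo) simp
  with Suc.prems(1) have "(\<lambda>n. poly p (1 / of_nat n)) \<in> O(\<lambda>n. 1 / of_nat n ^ 1)"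
    by (rule landau_o.big_trans)
  moreover have "(\<lambda>n. 1 / of_nat n ^ 1 :: complex) \<in> o(\<lambda>_. 1)"
    by (intro smalloI_tendsto) (use lim_1_over_n in simp_all)
  ultimately have "(\<lambda>n. poly p (1 / of_nat n)) \<in> o(\<lambda>_. 1)"
    by (rule landau_o.big_small_trans)
  hence "(\<lambda>n. poly p (1 / of_nat n)) \<longlonglongrightarrow> 0"
    using smalloD_tendsto[of _ _ "\<lambda>_. 1"] by simp
  from LIMSEQ_unique[OF this tendsto_poly_inverse_nat[of p]] have a: "a = 0"
    by (simp add: p)
  have scaled: "(\<lambda>n. of_nat n * poly p (1 / of_nat n)) \<in> O(\<lambda>n. of_nat n * (1 / of_nat n ^ Suc K))"
    by (intro landau_o.big.mult_left Suc.prems)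
  have ev1: "eventually (\<lambda>n. of_nat n * poly p (1 / of_nat n) = poly q (1 / of_nat n)) at_top"
    by (rule eventually_mono[OF eventually_gt_at_top[of 0]]) (simp add: p a)
  have ev2: "eventually (\<lambda>n. of_nat n * (1 / of_nat n ^ Suc K) = (1 / of_nat n ^ K :: complex)) at_top"
    by (rule eventually_mono[OF eventually_gt_at_top[of 0]]) simp
  have "(\<lambda>n. poly q (1 / of_nat n)) \<in> O(\<lambda>n. 1 / of_nat n ^ K)"
    using scaled unfolding landau_o.big.in_cong[OF ev1] landau_o.big.cong[OF ev2] .
  note IH = Suc.IH[OF this]
  show ?case
  proof (cases i)
    case (Suc j)
    thus ?thesis using IH[of j] Suc.prems(2) by (simp add: p)
  qed (simp add: p a)
qed (erule less_zeroE)

lemma poly_truncate: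
  fixes p :: "'a :: comm_ring_1 poly"
  shows "\<exists>q. \<forall>x. poly p x = (\<Sum>l<K. coeff p l * x ^ l) + x ^ K * poly q x"
proof (induction K arbitrary: p)
  case 0
  show ?case by auto
next
  case (Suc K)
  obtain a r where p: "p = pCons a r" by (cases p)
  from Suc.IH[of r] obtain q where
    q: "\<And>x. poly r x = (\<Sum>l<K. coeff r l * x ^ l) + x ^ K * poly q x" by blast
  show ?case
    by (intro exI[of _ q] allI)
      (simp add: p q sum.lessThan_Suc_shift sum_distrib_left algebra_simps del: sum.lessThan_Suc)
qed

lemma poly_inverse_nat_truncate:
  fixes p :: "complex poly"
  shows "(\<lambda>n. poly p (1 / of_nat n) - (\<Sum>l<K. coeff p l / of_nat n ^ l)) \<in> O(\<lambda>n. 1 / of_nat n ^ K)"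
proof -
  obtain q where q: "\<And>x. poly p x = (\<Sum>l<K. coeff p l * x ^ l) + x ^ K * poly q x"
    using poly_truncate by metis
  have "(\<lambda>n. 1 / of_nat n ^ K * poly q (1 / of_nat n)) \<in> O(\<lambda>n. 1 / of_nat n ^ K * 1)"
    by (intro landau_o.big.mult_left poly_inverse_nat_bigo_1)
  thus ?thesis by (simp add: q power_one_over)
qed

section \<open>Calculus of truncated expansions\<close>

text \<open>The degree of \<open>p\<close> is left unbounded, so the operations below need no
  truncation. Only the coefficients of index below \<open>K\<close> are determined by
  \<open>u\<close>; in particular \<open>C\<close> is meaningful for
  \<open>K \<ge> 1\<close>.\<close>

definition inverse_expansion :: "nat \<Rightarrow> complex \<Rightarrow> (nat \<Rightarrow> complex) \<Rightarrow> bool" where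
  "inverse_expansion K C u \<longleftrightarrow>
     (\<exists>p. coeff p 0 = C \<and> (\<lambda>n. u n - poly p (1 / of_nat n)) \<in> O(\<lambda>n. 1 / of_nat n ^ K))"

lemma inverse_expansion_bigo:
  "u \<in> O(\<lambda>n. 1 / of_nat n ^ K) \<Longrightarrow> inverse_expansion K 0 u"
  unfolding inverse_expansion_def by (intro exI[of _ 0]) auto

lemma inverse_expansion_add:
  assumes "inverse_expansion K C u" "inverse_expansion K C' u'"
  shows "inverse_expansion K (C + C') (\<lambda>n. u n + u' n)"
proof -
  obtain p p' where "coeff p 0 = C" "coeff p' 0 = C'"
    "(\<lambda>n. u n - poly p (1 / of_nat n)) \<in> O(\<lambda>n. 1 / of_nat n ^ K)"
    "(\<lambda>n. u' n - poly p' (1 / of_nat n)) \<in> O(\<lambda>n. 1 / of_nat n ^ K)"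
    using assms unfolding inverse_expansion_def by blast
  from this(1,2) sum_in_bigo(1)[OF this(3,4)] show ?thesis
    unfolding inverse_expansion_def by (intro exI[of _ "p + p'"]) (simp add: algebra_simps)
qed

lemma inverse_expansion_cmult:
  assumes "inverse_expansion K C u"
  shows "inverse_expansion K (c * C) (\<lambda>n. c * u n)"
proof -
  obtain p where p: "coeff p 0 = C" "(\<lambda>n. u n - poly p (1 / of_nat n)) \<in> O(\<lambda>n. 1 / of_nat n ^ K)"
    using assms unfolding inverse_expansion_def by blast
  have "(\<lambda>n. c * (u n - poly p (1 / of_nat n))) \<in> O(\<lambda>n. 1 / of_nat n ^ K)"
    using p(2) by (cases "c = 0") auto
  with p(1) show ?thesis
    unfolding inverse_expansion_def by (intro exI[of _ "smult c p"]) (simp add: algebra_simps)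
qed

lemma inverse_expansion_sum:
  "(\<And>j. j \<in> A \<Longrightarrow> inverse_expansion K (C j) (u j)) \<Longrightarrow>
     inverse_expansion K (\<Sum>j\<in>A. C j) (\<lambda>n. \<Sum>j\<in>A. u j n)"
proof (induction A rule: infinite_finite_induct)
  case (insert j A)
  from inverse_expansion_add[OF insert.prems insert.IH[OF insert.prems]] insert.hyps
  show ?case by simp
qed (simp_all add: inverse_expansion_bigo)

text \<open>The polynomial is multiplied by the \<open>k\<close>-th power of its variable, which
  kills the constant term unless \<open>k = 0\<close>. This is why higher odd powers of the square
  root do not affect \<open>C\<close>.\<close>

lemma inverse_expansion_divide_power:
  assumes "inverse_expansion K C u"
  shows "inverse_expansion K (if k = 0 then C else 0) (\<lambda>n. u n / of_nat n ^ k)"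
proof -
  obtain p where p: "coeff p 0 = C" "(\<lambda>n. u n - poly p (1 / of_nat n)) \<in> O(\<lambda>n. 1 / of_nat n ^ K)"
    using assms unfolding inverse_expansion_def by blast
  have "(\<lambda>n. (u n - poly p (1 / of_nat n)) * (1 / of_nat n ^ k)) \<in> O(\<lambda>n. 1 / of_nat n ^ K * 1)"
    using p(2) inverse_nat_power_bigo[of 0 k] by (intro landau_o.big.mult) auto
  with p(1) show ?thesis
    unfolding inverse_expansion_def
    by (intro exI[of _ "monom 1 k * p"])
      (simp add: coeff_mult poly_monom power_one_over algebra_simps diff_divide_distrib)
qed

lemma inverse_expansion_cong:
  assumes "inverse_expansion K C u" "eventually (\<lambda>n. u n = u' n) at_top"
  shows "inverse_expansion K C u'"
proof -
  obtain p where p: "coeff p 0 = C" "(\<lambda>n. u n - poly p (1 / of_nat n)) \<in> O(\<lambda>n. 1 / of_nat n ^ K)"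
    using assms unfolding inverse_expansion_def by blast
  have "(\<lambda>n. u' n - poly p (1 / of_nat n)) \<in> O(\<lambda>n. 1 / of_nat n ^ K)"
    using p(2) assms(2)
    by (subst landau_o.big.in_cong[where g = "\<lambda>n. u n - poly p (1 / of_nat n)"])
      (auto elim: eventually_mono)
  with p(1) show ?thesis unfolding inverse_expansion_def by blast
qed

section \<open>Expansions from first order recurrences\<close>

text \<open>As \<open>t\<close> tends to 0, \<open>- t n\<close> is the sum of all later
  differences. Their bounds are dominated by the telescoping differences of
  \<open>1 / n ^ (m + 1)\<close>, so summation costs one power of \<open>n\<close>.\<close>

lemma bigo_of_differences:
  fixes t :: "nat \<Rightarrow> complex"
  assumes lim: "t \<longlonglongrightarrow> 0"
    and diff: "eventually (\<lambda>n. norm (t (Suc n) - t n) \<le> A / real n ^ (m + 2)) at_top"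
  shows "t \<in> O(\<lambda>n. 1 / of_nat n ^ (m + 1))"
proof -
  define y where "y n = 1 / real n ^ (m + 1)" for n
  \<comment> \<open>The drop of \<open>y\<close> is at least \<open>y n / (n + 1)\<close>, and
    \<open>n + 1 \<le> 2 * n\<close> gives the factor 2.\<close>
  have y_diff: "1 / real n ^ (m + 2) \<le> 2 * (y n - y (Suc n))" if "n \<ge> 1" for n
  proof -
    let ?x = "real n"
    have x: "?x \<ge> 1" using that by simp
    have "(?x / (?x + 1)) ^ (m + 1) \<le> ?x / (?x + 1)"
      using x power_decreasing[of 1 "m + 1" "?x / (?x + 1)"] by simp
    moreover have "y (Suc n) = y n * (?x / (?x + 1)) ^ (m + 1)"
      using x by (simp add: y_def power_divide add.commute)
    ultimately have "y (Suc n) \<le> y n * (?x / (?x + 1))"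
      using mult_left_mono[of "(?x / (?x + 1)) ^ (m + 1)" "?x / (?x + 1)" "y n"]
      by (simp add: y_def del: power_Suc)
    hence le: "y n * (1 - ?x / (?x + 1)) \<le> y n - y (Suc n)"
      by (simp add: algebra_simps)
    have "1 / (2 * ?x) \<le> 1 - ?x / (?x + 1)"
      using x by (simp add: field_simps)
    hence "y n * (1 / (2 * ?x)) \<le> y n * (1 - ?x / (?x + 1))"
      by (intro mult_left_mono) (auto simp: y_def)
    hence "2 * (y n * (1 / (2 * ?x))) \<le> 2 * (y n - y (Suc n))"
      using le by (meson mult_left_mono order_trans zero_le_numeral)
    moreover have "2 * (y n * (1 / (2 * ?x))) = 1 / ?x ^ (m + 2)"
      using x by (simp add: y_def field_simps)
    ultimately show ?thesis by simp
  qed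
  obtain N where N: "N \<ge> 1" "\<And>n. n \<ge> N \<Longrightarrow> norm (t (Suc n) - t n) \<le> A / real n ^ (m + 2)"
    using diff unfolding eventually_at_top_linorder by (metis le_trans nle_le)
  have "0 < real N ^ (m + 2)" using N(1) by simp
  hence A: "A \<ge> 0"
    using order_trans[OF norm_ge_zero N(2)[of N]] by (meson divide_neg_pos not_le order_refl)
  have tele: "norm (t (n + k) - t n) \<le> 2 * A * (y n - y (n + k))" if "n \<ge> N" for n k
  proof (induction k)
    case (Suc k)
    have "norm (t (Suc (n + k)) - t (n + k)) \<le> A * (1 / real (n + k) ^ (m + 2))"
      using N(2)[of "n + k"] that by simp
    also have "\<dots> \<le> A * (2 * (y (n + k) - y (Suc (n + k))))"
      using A that N(1) by (intro mult_left_mono y_diff) auto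
    finally have "norm (t (n + Suc k) - t (n + k)) \<le> 2 * A * (y (n + k) - y (n + Suc k))"
      by (simp only: add_Suc_right mult.assoc mult.left_commute[of A])
    from norm_diff_triangle_le[OF this Suc.IH]
    show ?case by (simp only: right_diff_distrib diff_add_cancel add_diff_eq)
  qed simp
  have "norm (t n) \<le> 2 * A * y n" if "n \<ge> N" for n
  proof (rule tendsto_upperbound)
    show "(\<lambda>k. norm (t (n + k) - t n)) \<longlonglongrightarrow> norm (t n)"
    proof -
      have "(\<lambda>k. t (k + n)) \<longlonglongrightarrow> 0"
        using lim by (rule LIMSEQ_ignore_initial_segment)
      hence "(\<lambda>k. norm (t (k + n) - t n)) \<longlonglongrightarrow> norm (0 - t n)"
        by (rule tendsto_norm[OF tendsto_diff[OF _ tendsto_const]])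
      thus ?thesis by (simp add: add.commute[of n] del: tendsto_norm_zero_iff)
    qed
    have "2 * A * (y n - y (n + k)) \<le> 2 * A * y n" for k
      using A by (intro mult_left_mono) (auto simp: y_def)
    thus "eventually (\<lambda>k. norm (t (n + k) - t n) \<le> 2 * A * y n) at_top"
      by (intro always_eventually allI order_trans[OF tele[OF that]])
  qed simp
  thus ?thesis
    by (intro bigoI[of _ "2 * A"] eventually_at_top_linorderI[of N])
      (simp only: y_def norm_divide norm_power norm_of_nat norm_one times_divide_eq_right mult_1_right)
qed

text \<open>
  Under the substitution \<open>x = 1 / n\<close> the shift \<open>n \<mapsto> n + 1\<close> becomes \<open>x \<mapsto> x / (1 + x)\<close>. As
  \<open>x\<^sup>m\<close> is moved by \<open>- m x\<^sup>m\<^sup>+\<^sup>1 + O(x\<^sup>m\<^sup>+\<^sup>2)\<close>, the recurrence can be solved one order at a time.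
\<close>

lemma approximate_solution_of_recurrence:
  fixes \<phi> :: "complex \<Rightarrow> complex"
  assumes \<phi>: "\<phi> holomorphic_on ball 0 1" "\<phi> 0 = 1" "deriv \<phi> 0 = 0"
  shows "\<exists>v \<psi>. coeff v 0 = 1 \<and> \<psi> holomorphic_on ball 0 1 \<and>
           (\<forall>x\<in>ball 0 1. poly v (x / (1 + x)) - \<phi> x * poly v x = x ^ (K + 2) * \<psi> x)"
proof (induction K)
  case 0
  obtain q where q: "q holomorphic_on ball 0 1" "q 0 = 0" "\<And>x. \<phi> x = 1 + x * q x"
    using holomorphic_divide_out_at_0[OF \<phi>(1) open_ball] \<phi>(2,3) by metis
  obtain q' where q': "q' holomorphic_on ball 0 1" "\<And>x. q x = x * q' x"
    using holomorphic_divide_out_at_0[OF q(1) open_ball] q(2) by (metis add_0)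
  \<comment> \<open>Here \<open>\<phi> x = 1 + x^2 * q' x\<close>, so the constant solution 1 leaves
    the defect \<open>- x^2 * q' x\<close>.\<close>
  show ?case
    using q(3) q' by (intro exI[of _ 1] exI[of _ "\<lambda>x. - q' x"] conjI ballI holomorphic_intros)
      (simp_all add: power2_eq_square)
next
  case (Suc K)
  then obtain v \<psi> where v: "coeff v 0 = 1" and \<psi>: "\<psi> holomorphic_on ball 0 1"
    and eq: "\<And>x. x \<in> ball 0 1 \<Longrightarrow> poly v (x / (1 + x)) - \<phi> x * poly v x = x ^ (K + 2) * \<psi> x"
    by blast
  \<comment> \<open>Adding \<open>c * x^(K+1)\<close> to \<open>v\<close> changes the defect by
    \<open>c * x^(K+1) * \<delta> x\<close>. Since \<open>\<phi>\<close> is stationary at 0,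
    \<open>\<delta>\<close> vanishes there with the nonzero slope \<open>- (K + 1)\<close>.\<close>
  define \<delta> where "\<delta> x = inverse (1 + x) ^ (K + 1) - \<phi> x" for x
  have nz: "1 + x \<noteq> 0" if "x \<in> ball 0 1" for x :: complex
    using that by (metis add_eq_0_iff2 mem_ball_0 norm_minus_cancel norm_one order_less_irrefl)
  have holo: "\<delta> holomorphic_on ball 0 1"
    unfolding \<delta>_def using nz by (intro holomorphic_intros \<phi>(1)) auto
  have "(\<phi> has_field_derivative 0) (at 0)"
    using holomorphic_derivI[OF \<phi>(1) open_ball, of 0] \<phi>(3) by simp
  hence "(\<delta> has_field_derivative - of_nat (K + 1)) (at 0)"
    unfolding \<delta>_def by (auto intro!: derivative_eq_intros)
  hence d\<delta>: "deriv \<delta> 0 = - of_nat (K + 1)"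
    by (rule DERIV_imp_deriv)
  have "\<delta> 0 = 0" using \<phi>(2) by (simp add: \<delta>_def)
  then obtain \<delta>' where \<delta>': "\<delta>' holomorphic_on ball 0 1" "\<delta>' 0 = - of_nat (K + 1)"
    "\<And>x. \<delta> x = x * \<delta>' x"
    using holomorphic_divide_out_at_0[OF holo open_ball] d\<delta> by (metis add_0)
  \<comment> \<open>Chosen to cancel the lowest term of the defect:
    \<open>\<psi> 0 + c * \<delta>' 0 = 0\<close>.\<close>
  define c where "c = \<psi> 0 / of_nat (K + 1)"
  define \<theta> where "\<theta> x = \<psi> x + c * \<delta>' x" for x
  have "\<theta> holomorphic_on ball 0 1"
    unfolding \<theta>_def by (intro holomorphic_intros \<psi> \<delta>'(1))
  moreover have "\<theta> 0 = 0"
    by (simp add: \<theta>_def \<delta>'(2) c_def del: of_nat_Suc of_nat_add)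
  ultimately obtain \<theta>' where \<theta>': "\<theta>' holomorphic_on ball 0 1" "\<And>x. \<theta> x = x * \<theta>' x"
    using holomorphic_divide_out_at_0[OF _ open_ball] by (metis add_0)
  show ?case
  proof (intro exI[of _ "v + monom c (K + 1)"] exI[of _ \<theta>'] conjI ballI)
    fix x :: complex
    assume x: "x \<in> ball 0 1"
    have "(x / (1 + x)) ^ (K + 1) - \<phi> x * x ^ (K + 1) = x ^ (K + 1) * \<delta> x"
      unfolding \<delta>_def by (simp only: divide_inverse power_mult_distrib right_diff_distrib mult.commute)
    also have "\<dots> = x ^ (K + 2) * \<delta>' x"
      by (simp add: \<delta>'(3))
    finally have \<delta>_eq: "(x / (1 + x)) ^ (K + 1) - \<phi> x * x ^ (K + 1) = x ^ (K + 2) * \<delta>' x" .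
    have "poly (v + monom c (K + 1)) (x / (1 + x)) - \<phi> x * poly (v + monom c (K + 1)) x =
        (poly v (x / (1 + x)) - \<phi> x * poly v x) +
        c * ((x / (1 + x)) ^ (K + 1) - \<phi> x * x ^ (K + 1))"
      by (simp only: poly_add poly_monom) (simp only: algebra_simps)
    also have "\<dots> = (poly v (x / (1 + x)) - \<phi> x * poly v x) + c * (x ^ (K + 2) * \<delta>' x)"
      by (simp only: \<delta>_eq)
    also have "\<dots> = x ^ (K + 2) * \<theta> x"
      unfolding eq[OF x] by (simp add: \<theta>_def algebra_simps)
    finally show "poly (v + monom c (K + 1)) (x / (1 + x)) - \<phi> x * poly (v + monom c (K + 1)) x =
        x ^ (Suc K + 2) * \<theta>' x"
      by (simp add: \<theta>'(2))
  qed (use v \<theta>'(1) in auto)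
qed

text \<open>The sequence is compared with \<open>C * v (1 / n)\<close>, where \<open>v\<close>
  solves the recurrence up to order \<open>K + 2\<close>. The limit of \<open>u\<close> fixes the
  scale, and \<open>C \<noteq> 0\<close> keeps \<open>u\<close> away from 0 eventually, so that
  dividing by it is harmless.\<close>

lemma inverse_expansion_of_recurrence:
  fixes u :: "nat \<Rightarrow> complex"
  assumes \<phi>: "\<phi> holomorphic_on ball 0 1" "\<phi> 0 = 1" "deriv \<phi> 0 = 0"
    and rec: "\<And>n. n \<ge> 2 \<Longrightarrow> u (Suc n) = \<phi> (1 / of_nat n) * u n"
    and lim: "u \<longlonglongrightarrow> C" and C: "C \<noteq> 0"
  shows "inverse_expansion (K + 1) C u"
proof -
  obtain v \<psi> where v: "coeff v 0 = 1" and \<psi>: "\<psi> holomorphic_on ball 0 1"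
    and eq: "\<And>x. x \<in> ball 0 1 \<Longrightarrow> poly v (x / (1 + x)) - \<phi> x * poly v x = x ^ (K + 2) * \<psi> x"
    using approximate_solution_of_recurrence[OF \<phi>, of K] by blast
  \<comment> \<open>\<open>\<psi>\<close> may be unbounded near the unit circle; for
    \<open>n \<ge> 2\<close> the points \<open>1 / n\<close> stay in this smaller disc.\<close>
  have "compact (\<psi> ` cball 0 (1 / 2))"
    by (intro compact_continuous_image continuous_on_subset[OF holomorphic_on_imp_continuous_on[OF \<psi>]])
      auto
  then obtain B where B: "\<And>x. x \<in> cball 0 (1 / 2) \<Longrightarrow> norm (\<psi> x) \<le> B"
    unfolding bounded_iff by (meson bounded_iff compact_imp_bounded imageI)
  define s where "s n = u n - C * poly v (1 / of_nat n)" for n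
  \<comment> \<open>Variation of constants: dividing by the exact solution \<open>u\<close> turns
    the perturbed recurrence for \<open>s\<close> into a plain difference
    \<open>t (Suc n) - t n\<close> of order \<open>1 / n ^ (K + 2)\<close>.\<close>
  define t where "t n = s n / u n" for n
  have s_rec: "s (Suc n) - \<phi> (1 / of_nat n) * s n = - C * ((1 / of_nat n) ^ (K + 2) * \<psi> (1 / of_nat n))"
    if "n \<ge> 2" for n
  proof -
    have "1 / of_nat n \<in> ball (0 :: complex) 1"
      using that by (simp add: norm_divide field_simps)
    moreover have "1 / of_nat n / (1 + 1 / of_nat n) = (1 / of_nat (Suc n) :: complex)"
      using that by (simp add: field_simps)
    ultimately have "poly v (1 / of_nat (Suc n)) - \<phi> (1 / of_nat n) * poly v (1 / of_nat n) =
        (1 / of_nat n) ^ (K + 2) * \<psi> (1 / of_nat n)"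
      using eq by metis
    moreover have "s (Suc n) - \<phi> (1 / of_nat n) * s n =
        - C * (poly v (1 / of_nat (Suc n)) - \<phi> (1 / of_nat n) * poly v (1 / of_nat n))"
      by (simp add: s_def rec[OF that] algebra_simps)
    ultimately show ?thesis by simp
  qed
  have "eventually (\<lambda>n. norm (u n) > norm C / 2) at_top"
    using C by (intro order_tendstoD[OF tendsto_norm[OF lim]]) auto
  then obtain N where N: "\<And>n. n \<ge> N \<Longrightarrow> norm (u n) > norm C / 2"
    unfolding eventually_at_top_linorder by blast
  have u_nz: "u n \<noteq> 0" if "n \<ge> N" for n
    using N[OF that] by auto
  have "norm (t (Suc n) - t n) \<le> 2 * B / real n ^ (K + 2)" if n: "n \<ge> max N 2" for n
  proof -
    have nz: "u n \<noteq> 0" "u (Suc n) \<noteq> 0" using n u_nz by auto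
    have "t n = \<phi> (1 / of_nat n) * s n / u (Suc n)"
      using nz n rec[of n] by (auto simp: t_def)
    hence "t (Suc n) - t n = (s (Suc n) - \<phi> (1 / of_nat n) * s n) / u (Suc n)"
      by (simp add: t_def diff_divide_distrib)
    hence "t (Suc n) - t n = - C * ((1 / of_nat n) ^ (K + 2) * \<psi> (1 / of_nat n)) / u (Suc n)"
      using s_rec[of n] n by simp
    hence "norm (t (Suc n) - t n) =
        (norm C / norm (u (Suc n))) * norm (\<psi> (1 / of_nat n)) * (1 / real n ^ (K + 2))"
      by (simp only: norm_mult norm_divide norm_minus_cancel norm_power norm_of_nat norm_one
          power_one_over) simp
    also have "\<dots> \<le> 2 * B * (1 / real n ^ (K + 2))"
    proof (intro mult_right_mono mult_mono)
      show "norm C / norm (u (Suc n)) \<le> 2"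
        using N[of "Suc n"] n nz by (simp add: divide_le_eq)
      show "norm (\<psi> (1 / of_nat n)) \<le> B"
        using n by (intro B) (simp add: norm_divide field_simps)
    qed auto
    finally show ?thesis by simp
  qed
  hence "eventually (\<lambda>n. norm (t (Suc n) - t n) \<le> 2 * B / real n ^ (K + 2)) at_top"
    unfolding eventually_at_top_linorder by blast
  moreover have "t \<longlonglongrightarrow> (C - C * coeff v 0) / C"
    unfolding t_def s_def by (intro tendsto_intros lim tendsto_poly_inverse_nat C)
  hence "t \<longlonglongrightarrow> 0" using v by simp
  ultimately have "t \<in> O(\<lambda>n. 1 / of_nat n ^ (K + 1))"
    by (intro bigo_of_differences)
  moreover have "u \<in> O(\<lambda>_. 1)"
    by (rule bigoI_tendsto[OF _ _ ]) (use lim in auto)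
  ultimately have "(\<lambda>n. t n * u n) \<in> O(\<lambda>n. 1 / of_nat n ^ (K + 1) * 1)"
    by (rule landau_o.big.mult)
  moreover have ev: "eventually (\<lambda>n. t n * u n = s n) at_top"
    using u_nz by (intro eventually_at_top_linorderI[of N]) (simp add: t_def)
  ultimately have "s \<in> O(\<lambda>n. 1 / of_nat n ^ (K + 1))"
    unfolding landau_o.big.in_cong[OF ev] by simp
  thus ?thesis
    unfolding inverse_expansion_def s_def using v by (intro exI[of _ "smult C v"]) simp
qed

section \<open>Coefficients of the powers of the square root\<close>

text \<open>The factor \<open>n\<close> to the power \<open>\<alpha> + 1\<close> makes the sequence
  converge, and its consecutive ratios are values at \<open>1 / n\<close> of a function with value 1
  and derivative 0 at 0. Excluding \<open>\<alpha> \<in> \<nat>\<close> makes the limit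
  nonzero.\<close>

lemma gbinomial_inverse_expansion:
  fixes \<alpha> :: complex
  assumes \<alpha>: "\<alpha> \<notin> \<nat>"
  shows "inverse_expansion (K + 1) (rGamma (- \<alpha>))
           (\<lambda>n. (- 1) ^ n * (\<alpha> gchoose n) * exp ((\<alpha> + 1) * of_real (ln (real n))))"
proof (rule inverse_expansion_of_recurrence)
  let ?u = "\<lambda>n. (- 1) ^ n * (\<alpha> gchoose n) * exp ((\<alpha> + 1) * of_real (ln (real n)))"
  \<comment> \<open>The quotient is the ratio of signed binomial coefficients at
    \<open>x = 1 / n\<close>, the exponential that of the powers of \<open>n\<close>. Together they
    are \<open>(1 - \<alpha> x)(1 + x)^\<alpha>\<close>, with derivative
    \<open>- \<alpha> + \<alpha> = 0\<close> at 0.\<close>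
  define \<phi> where "\<phi> x = (1 - \<alpha> * x) / (1 + x) * exp ((\<alpha> + 1) * Ln (1 + x))" for x
  have re: "Re (1 + x) > 0" if "x \<in> ball 0 1" for x
    using that abs_Re_le_cmod[of x] by simp
  have nz: "1 + x \<noteq> 0" "1 + x \<notin> \<real>\<^sub>\<le>\<^sub>0" if "x \<in> ball 0 1" for x :: complex
    using re[OF that] by (auto simp: complex_nonpos_Reals_iff complex_eq_iff)
  show "\<phi> holomorphic_on ball 0 1"
    unfolding \<phi>_def using nz by (intro holomorphic_intros) auto
  show "\<phi> 0 = 1" by (simp add: \<phi>_def)
  have "(\<phi> has_field_derivative 0) (at 0)"
    unfolding \<phi>_def by (auto intro!: derivative_eq_intros)
  thus "deriv \<phi> 0 = 0" by (rule DERIV_imp_deriv)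
  have "x / ((- 1) ^ n / e) = (- 1) ^ n * x * e" for x e :: complex and n
    by (cases "even n") auto
  thus "?u \<longlonglongrightarrow> rGamma (- \<alpha>)"
    using gbinomial_asymptotic[of \<alpha>] by (simp only: rGamma_inverse_Gamma)
  have "- \<alpha> \<notin> \<int>\<^sub>\<le>\<^sub>0"
    using \<alpha> by (auto elim!: nonpos_Ints_cases')
  thus "rGamma (- \<alpha>) \<noteq> 0" by (simp add: rGamma_eq_zero_iff)
  fix n :: nat
  assume "n \<ge> 2"
  hence n: "real n > 0" by simp
  have "Ln (1 + 1 / of_nat n) = of_real (ln (1 + 1 / real n))"
    using n Ln_of_real[of "1 + 1 / real n"] by (simp add: add_pos_pos)
  also have "1 + 1 / real n = real (Suc n) / real n"
    using n by (simp add: field_simps)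
  finally have Ln_eq: "of_real (ln (real (Suc n))) = Ln (1 + 1 / of_nat n) + of_real (ln (real n))"
    using n by (simp add: ln_div)
  have "exp ((\<alpha> + 1) * of_real (ln (real (Suc n)))) =
      exp ((\<alpha> + 1) * Ln (1 + 1 / of_nat n)) * exp ((\<alpha> + 1) * of_real (ln (real n)))"
    unfolding Ln_eq by (simp only: distrib_left exp_add)
  moreover have "(\<alpha> gchoose Suc n) = (\<alpha> gchoose n) * ((\<alpha> - of_nat n) / of_nat (Suc n))"
    using gbinomial_mult_1[of \<alpha> n] by (simp add: field_simps del: of_nat_Suc)
  moreover have "(1 - \<alpha> * (1 / of_nat n)) / (1 + 1 / of_nat n) = - ((\<alpha> - of_nat n) / of_nat (Suc n))"
  proof -
    have eqs: "1 - \<alpha> * (1 / of_nat n) = - (\<alpha> - of_nat n) / of_nat n"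
      "1 + 1 / of_nat n = (of_nat (Suc n) / of_nat n :: complex)"
      using n by (simp_all add: diff_divide_distrib add_divide_distrib)
    show ?thesis
      unfolding eqs using n by (simp del: of_nat_Suc add: minus_divide_left)
  qed
  ultimately show "?u (Suc n) = \<phi> (1 / of_nat n) * ?u n"
    by (simp add: \<phi>_def)
qed

lemma csqrt_one_minus_power_has_fps_expansion:
  "(\<lambda>z. csqrt (1 - z) ^ j) has_fps_expansion Abs_fps (\<lambda>n. (- 1) ^ n * ((of_nat j / 2) gchoose n))"
proof (rule has_fps_expansionI)
  have "(\<lambda>n. fps_nth (Abs_fps (\<lambda>n. (- 1) ^ n * ((of_nat j / 2) gchoose n))) n * z ^ n) sums
          csqrt (1 - z) ^ j" if z: "z \<in> ball 0 1" for z
  proof -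
    have "1 - z \<noteq> 0" using z by auto
    hence "csqrt (1 - z) ^ j = (1 + - z) powr (of_nat j / 2)"
      by (simp add: csqrt_conv_powr powr_power)
    moreover have "(\<lambda>n. ((of_nat j / 2) gchoose n) * (- z) ^ n) sums (1 + - z) powr (of_nat j / 2)"
      using z by (intro gen_binomial_complex) simp
    moreover have "(- z) ^ n = (- 1) ^ n * z ^ n" for n
      by (simp flip: power_mult_distrib)
    ultimately show ?thesis by (simp add: mult_ac)
  qed
  thus "eventually (\<lambda>z. (\<lambda>n. fps_nth (Abs_fps (\<lambda>n. (- 1) ^ n * ((of_nat j / 2) gchoose n))) n * z ^ n)
          sums (csqrt (1 - z) ^ j)) (nhds 0)"
    by (intro eventually_nhds_in_open[THEN eventually_mono, of "ball 0 1"]) auto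
qed

text \<open>The functional equation reduces this to \<open>Gamma (1 / 2) = sqrt pi\<close>; it is
  the source of the numerical factor in \<open>C\<close>.\<close>

lemma rGamma_minus_one_half: "rGamma (- (1 / 2)) = - 1 / (2 * of_real (sqrt pi) :: complex)"
  using rGamma_plus1[of "- (1 / 2) :: complex"]
  by (simp add: rGamma_inverse_Gamma Gamma_one_half_complex field_simps)

text \<open>For even \<open>j\<close> the power is a polynomial in \<open>z\<close>, so the
  coefficients vanish eventually. For \<open>j = 2 * k + 1\<close> the natural scale is
  \<open>n\<close> to the power \<open>j / 2 + 1 = k + 3 / 2\<close>; passing to
  \<open>3 / 2\<close> divides by \<open>n ^ k\<close>, and the leading constant survives only for
  \<open>k = 0\<close>.\<close>

lemma csqrt_power_coeff_inverse_expansion: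
  "inverse_expansion (K + 1) (if j = 1 then - 1 / (2 * of_real (sqrt pi)) else 0)
     (\<lambda>n. of_real (real n powr (3 / 2)) * ((- 1) ^ n * ((of_nat j / 2) gchoose n)))"
proof (cases "even j")
  case True
  then obtain i where j: "j = 2 * i" by blast
  have "inverse_expansion (K + 1) 0 (\<lambda>_. 0)"
    by (rule inverse_expansion_bigo) simp
  moreover have "(of_nat j / 2 :: complex) gchoose n = 0" if "n > i" for n
    using that binomial_gbinomial[of i n, where 'a = complex] by (simp add: j binomial_eq_0)
  hence "eventually (\<lambda>n. 0 = of_real (real n powr (3 / 2)) *
      ((- 1) ^ n * ((of_nat j / 2 :: complex) gchoose n))) at_top"
    by (intro eventually_at_top_linorderI[of "Suc i"]) simp
  ultimately have "inverse_expansion (K + 1) 0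
      (\<lambda>n. of_real (real n powr (3 / 2)) * ((- 1) ^ n * ((of_nat j / 2) gchoose n)))"
    by (rule inverse_expansion_cong)
  moreover have "j \<noteq> 1" using True by auto
  ultimately show ?thesis by (simp only: if_False)
next
  case False
  then obtain k where j: "j = 2 * k + 1" by (elim oddE)
  let ?\<alpha> = "of_nat j / 2 :: complex"
  have "?\<alpha> \<notin> \<nat>"
  proof
    assume "?\<alpha> \<in> \<nat>"
    then obtain i where "?\<alpha> = of_nat i" by (elim Nats_cases)
    hence "(of_nat j :: complex) = of_nat (2 * i)" by (simp add: field_simps)
    hence "j = 2 * i" by (simp only: of_nat_eq_iff)
    with j show False by presburger
  qed
  note exp = inverse_expansion_divide_power[OF gbinomial_inverse_expansion[OF this, of K], of k]
  have "(- 1) ^ n * (?\<alpha> gchoose n) * exp ((?\<alpha> + 1) * of_real (ln (real n))) / of_nat n ^ k =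
      of_real (real n powr (3 / 2)) * ((- 1) ^ n * (?\<alpha> gchoose n))" if "n \<ge> 1" for n
  proof -
    have "exp ((?\<alpha> + 1) * of_real (ln (real n))) = of_real (exp ((real k + 3 / 2) * ln (real n)))"
      by (simp add: j add_divide_distrib add.commute flip: exp_of_real)
    also have "exp ((real k + 3 / 2) * ln (real n)) = real n powr (real k + 3 / 2)"
      using that by (simp add: powr_def)
    also have "\<dots> = real n ^ k * real n powr (3 / 2)"
      using that by (simp add: powr_add powr_realpow)
    finally show ?thesis using that by simp
  qed
  hence "eventually (\<lambda>n. (- 1) ^ n * (?\<alpha> gchoose n) * exp ((?\<alpha> + 1) * of_real (ln (real n))) / of_nat n ^ k =
      of_real (real n powr (3 / 2)) * ((- 1) ^ n * (?\<alpha> gchoose n))) at_top"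
    by (rule eventually_at_top_linorderI)
  note inverse_expansion_cong[OF exp this]
  moreover have "(if k = 0 then rGamma (- ?\<alpha>) else 0) = (if j = 1 then - 1 / (2 * of_real (sqrt pi)) else 0)"
    using rGamma_minus_one_half by (cases "k = 0") (simp_all add: j)
  ultimately show ?thesis by (simp only:)
qed

section \<open>Assembling the expansion, its existence and uniqueness\<close>

lemma csqrt_coeff_inverse_expansion:
  assumes F: "(\<lambda>z. h (csqrt (1 - z))) has_fps_expansion F"
    and U: "open U" "closure (csqrt ` ball 1 1) \<subseteq> U" and h: "h holomorphic_on U"
  shows "inverse_expansion (K + 1) (- deriv h 0 / (2 * of_real (sqrt pi)))
           (\<lambda>n. of_real (real n powr (3 / 2)) * fps_nth F n)"
proof -
  \<comment> \<open>Then \<open>m + 2 = 2 * (K + 3)\<close>, so the remainder has coefficients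
    \<open>O(1 / n ^ (K + 3))\<close>. The weight \<open>n powr (3 / 2) \<le> n ^ 2\<close> costs
    two powers at most and leaves the required \<open>K + 1\<close>.\<close>
  define m where "m = 2 * K + 4"
  obtain d H where d1: "d 1 = deriv h 0" and H: "H holomorphic_on U"
    and h_eq: "\<And>w. h w = (\<Sum>j<m + 2. d j * w ^ j) + w ^ (m + 2) * H w"
    using holomorphic_taylor_remainder_at_0[OF h U(1)] by blast
  define b where "b j n = (- 1) ^ n * ((of_nat j / 2 :: complex) gchoose n)" for j n
  define R where "R = F - (\<Sum>j<m + 2. fps_const (d j) * Abs_fps (b j))"
  have "(\<lambda>z. h (csqrt (1 - z)) - (\<Sum>j<m + 2. d j * csqrt (1 - z) ^ j)) has_fps_expansion R"
    unfolding R_def b_def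
    by (intro has_fps_expansion_diff F has_fps_expansion_sum has_fps_expansion_cmult_left
        csqrt_one_minus_power_has_fps_expansion)
  moreover have "h w - (\<Sum>j<m + 2. d j * w ^ j) = w ^ (2 * (K + 3)) * H w" for w
    unfolding h_eq[of w] by (simp add: m_def algebra_simps)
  ultimately have "(\<lambda>z. csqrt (1 - z) ^ (2 * (K + 3)) * H (csqrt (1 - z))) has_fps_expansion R"
    by simp
  from csqrt_remainder_coeff_bound[OF U H this] obtain B where
    B: "\<And>n. norm (fps_nth R n) * real (n + 1) ^ (K + 3) \<le> B" by blast
  have "norm (of_real (real n powr (3 / 2)) * fps_nth R n) \<le> B * norm (1 / of_nat n ^ (K + 1) :: complex)"
    if "n \<ge> 1" for n
  proof -
    have n: "real n \<ge> 1" using that by simp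
    have "real n powr (3 / 2) \<le> real n powr 2"
      using n by (intro powr_mono) auto
    hence "real n powr (3 / 2) * real n ^ (K + 1) \<le> real n ^ 2 * real n ^ (K + 1)"
      using n by (intro mult_right_mono) (auto simp: powr_realpow[of "real n" 2, simplified])
    also have "\<dots> = real n ^ (K + 3)"
      by (simp add: power_add power2_eq_square power3_eq_cube)
    also have "\<dots> \<le> real (n + 1) ^ (K + 3)"
      by (intro power_mono) auto
    finally have "norm (fps_nth R n) * (real n powr (3 / 2) * real n ^ (K + 1)) \<le> B"
      using B[of n] by (meson mult_left_mono norm_ge_zero order_trans)
    thus ?thesis
      using n by (simp add: norm_mult norm_divide norm_power pos_le_divide_eq mult_ac)
  qed
  hence "(\<lambda>n. of_real (real n powr (3 / 2)) * fps_nth R n) \<in> O(\<lambda>n. 1 / of_nat n ^ (K + 1))"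
    by (intro bigoI eventually_at_top_linorderI)
  hence "inverse_expansion (K + 1) 0 (\<lambda>n. of_real (real n powr (3 / 2)) * fps_nth R n)"
    by (rule inverse_expansion_bigo)
  moreover have "inverse_expansion (K + 1)
      (\<Sum>j<m + 2. d j * (if j = 1 then - 1 / (2 * of_real (sqrt pi)) else 0))
      (\<lambda>n. \<Sum>j<m + 2. d j * (of_real (real n powr (3 / 2)) * b j n))"
    unfolding b_def
    by (intro inverse_expansion_sum inverse_expansion_cmult csqrt_power_coeff_inverse_expansion)
  ultimately have "inverse_expansion (K + 1)
      (0 + (\<Sum>j<m + 2. d j * (if j = 1 then - 1 / (2 * of_real (sqrt pi)) else 0)))
      (\<lambda>n. of_real (real n powr (3 / 2)) * fps_nth R n +
        (\<Sum>j<m + 2. d j * (of_real (real n powr (3 / 2)) * b j n)))"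
    by (rule inverse_expansion_add)
  moreover have "(\<Sum>j<m + 2. d j * (if j = 1 then - 1 / (2 * of_real (sqrt pi)) else 0)) =
      - deriv h 0 / (2 * of_real (sqrt pi))"
  proof -
    have "(\<Sum>j<m + 2. d j * (if j = 1 then - 1 / (2 * of_real (sqrt pi)) else 0)) =
        (\<Sum>j<m + 2. if j = 1 then d j * (- 1 / (2 * of_real (sqrt pi))) else 0)"
      by (intro sum.cong) auto
    thus ?thesis by (simp only: sum.delta finite_lessThan) (simp add: flip: d1)
  qed
  moreover have "of_real (real n powr (3 / 2)) * fps_nth R n +
      (\<Sum>j<m + 2. d j * (of_real (real n powr (3 / 2)) * b j n)) =
      of_real (real n powr (3 / 2)) * fps_nth F n" for n
    by (simp add: R_def fps_sum_nth sum_distrib_left right_diff_distrib mult.left_commute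
        del: sum.lessThan_Suc add_2_eq_Suc')
  ultimately show ?thesis by simp
qed

text \<open>The hypothesis provides a separate polynomial for every \<open>K\<close>, whereas one
  sequence must serve all \<open>K\<close>. Two of these polynomials approximate the same sequence,
  so they agree in all coefficients that both orders determine.\<close>

lemma has_three_halves_expansion_ex:
  assumes "\<And>K. inverse_expansion (K + 1) C (\<lambda>n. of_real (real n powr (3 / 2)) * a n)"
  shows "\<exists>c. has_three_halves_expansion a C c"
proof -
  define u where "u n = of_real (real n powr (3 / 2)) * a n" for n
  have "\<forall>K. \<exists>p. coeff p 0 = C \<and> (\<lambda>n. u n - poly p (1 / of_nat n)) \<in> O(\<lambda>n. 1 / of_nat n ^ (K + 1))"
    using assms unfolding inverse_expansion_def u_def by (rule allI)
  then obtain p where "\<forall>K. coeff (p K) 0 = C \<and>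
      (\<lambda>n. u n - poly (p K) (1 / of_nat n)) \<in> O(\<lambda>n. 1 / of_nat n ^ (K + 1))"
    by (rule choice[THEN exE])
  hence p0: "coeff (p K) 0 = C"
    and p: "(\<lambda>n. u n - poly (p K) (1 / of_nat n)) \<in> O(\<lambda>n. 1 / of_nat n ^ (K + 1))" for K
    by blast+
  \<comment> \<open>Diagonal choice: \<open>p l\<close> is the first polynomial whose order
    determines the coefficient of index \<open>l\<close>.\<close>
  define c where "c l = coeff (p l) l" for l
  have coherent: "coeff (p K) l = c l" if "l \<le> K" for K l
  proof -
    have "(\<lambda>n. u n - poly (p K) (1 / of_nat n)) \<in> O(\<lambda>n. 1 / of_nat n ^ (l + 1))"
      using that by (intro landau_o.big_trans[OF p inverse_nat_power_bigo]) simp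
    from sum_in_bigo(2)[OF this p[of l]]
    have "(\<lambda>n. poly (p l - p K) (1 / of_nat n)) \<in> O(\<lambda>n. 1 / of_nat n ^ (l + 1))"
      by simp
    from poly_inverse_nat_bigo_imp_coeff_eq_0[OF this, of l] show ?thesis
      by (simp add: c_def)
  qed
  show ?thesis
    unfolding has_three_halves_expansion_def
  proof (rule exI[of _ c], intro allI impI)
    fix K :: nat
    \<comment> \<open>With this choice the required identity is immediate for
      \<open>n \<ge> 1\<close>, and only the order of \<open>\<epsilon>\<close> remains to be
      shown.\<close>
    define \<epsilon> where "\<epsilon> n = u n - (C + (\<Sum>l = 1..K. c l / of_nat n ^ l))" for n
    have "(\<Sum>l<K + 1. coeff (p K) l / of_nat n ^ l) = C + (\<Sum>l = 1..K. c l / of_nat n ^ l)" for n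
    proof -
      have "(\<Sum>l<K + 1. coeff (p K) l / of_nat n ^ l) =
          (\<Sum>l\<in>insert 0 {1..K}. coeff (p K) l / of_nat n ^ l)"
        by (intro sum.cong) auto
      also have "\<dots> = C + (\<Sum>l = 1..K. coeff (p K) l / of_nat n ^ l)"
        by (simp add: p0)
      finally show ?thesis by (simp add: coherent)
    qed
    hence "\<epsilon> n = (u n - poly (p K) (1 / of_nat n)) +
        (poly (p K) (1 / of_nat n) - (\<Sum>l<K + 1. coeff (p K) l / of_nat n ^ l))" for n
      by (simp add: \<epsilon>_def)
    hence "\<epsilon> = (\<lambda>n. (u n - poly (p K) (1 / of_nat n)) +
        (poly (p K) (1 / of_nat n) - (\<Sum>l<K + 1. coeff (p K) l / of_nat n ^ l)))"
      by (rule ext)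
    with sum_in_bigo(1)[OF p poly_inverse_nat_truncate]
    have "\<epsilon> \<in> O(\<lambda>n. 1 / of_nat n ^ (K + 1))"
      by (rule ssubst[rotated])
    moreover have "a n = 1 / of_real (real n powr (3 / 2)) *
        (C + (\<Sum>l = 1..K. c l / of_nat n ^ l) + \<epsilon> n)" if "n \<ge> 1" for n
      using that by (simp add: \<epsilon>_def u_def)
    ultimately show "\<exists>\<epsilon>. \<epsilon> \<in> O(\<lambda>n. 1 / of_nat n ^ (K + 1)) \<and>
        (\<forall>n\<ge>1. a n = 1 / of_real (real n powr (3 / 2)) *
           (C + (\<Sum>l = 1..K. c l / of_nat n ^ l) + \<epsilon> n))"
      by (intro exI[of _ \<epsilon>] conjI allI impI)
  qed
qed

lemma has_three_halves_expansion_unique: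
  assumes "has_three_halves_expansion a C c" "has_three_halves_expansion a C' c'"
  shows "C' = C" "l \<ge> 1 \<Longrightarrow> c' l = c l"
proof -
  \<comment> \<open>The values \<open>c 0\<close> and \<open>c' 0\<close> are unconstrained, so
    index 0 is free to carry the difference of the constants. The polynomial in \<open>1 / n\<close>
    with coefficients \<open>e\<close> is a difference of two error terms, hence too small to be
    nonzero.\<close>
  define e where "e l = (if l = 0 then C - C' else c l - c' l)" for l
  have e0: "e i = 0" if K: "K \<ge> 1" and i: "i \<le> K" for K i
  proof -
    obtain \<epsilon> where \<epsilon>: "\<epsilon> \<in> O(\<lambda>n. 1 / of_nat n ^ (K + 1))"
      "\<And>n. n \<ge> 1 \<Longrightarrow> a n = 1 / of_real (real n powr (3 / 2)) * (C + (\<Sum>l = 1..K. c l / of_nat n ^ l) + \<epsilon> n)"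
      using assms(1) K unfolding has_three_halves_expansion_def by blast
    obtain \<epsilon>' where \<epsilon>': "\<epsilon>' \<in> O(\<lambda>n. 1 / of_nat n ^ (K + 1))"
      "\<And>n. n \<ge> 1 \<Longrightarrow> a n = 1 / of_real (real n powr (3 / 2)) * (C' + (\<Sum>l = 1..K. c' l / of_nat n ^ l) + \<epsilon>' n)"
      using assms(2) K unfolding has_three_halves_expansion_def by blast
    define q where "q = (\<Sum>l\<in>insert 0 {1..K}. monom (e l) l)"
    have "poly q (1 / of_nat n) = \<epsilon>' n - \<epsilon> n" if n: "n \<ge> 1" for n
    proof -
      have "C + (\<Sum>l = 1..K. c l / of_nat n ^ l) + \<epsilon> n = C' + (\<Sum>l = 1..K. c' l / of_nat n ^ l) + \<epsilon>' n"
        using \<epsilon>(2)[OF n] \<epsilon>'(2)[OF n] n by simp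
      moreover have "poly q (1 / of_nat n) =
          C - C' + ((\<Sum>l = 1..K. c l / of_nat n ^ l) - (\<Sum>l = 1..K. c' l / of_nat n ^ l))"
        by (simp add: q_def poly_sum poly_monom e_def power_one_over diff_divide_distrib
            flip: sum_subtractf)
      ultimately show ?thesis by algebra
    qed
    hence ev: "eventually (\<lambda>n. poly q (1 / of_nat n) = \<epsilon>' n - \<epsilon> n) at_top"
      by (rule eventually_at_top_linorderI)
    have "(\<lambda>n. poly q (1 / of_nat n)) \<in> O(\<lambda>n. 1 / of_nat n ^ (K + 1))"
      unfolding landau_o.big.in_cong[OF ev] by (intro sum_in_bigo \<epsilon>(1) \<epsilon>'(1))
    from poly_inverse_nat_bigo_imp_coeff_eq_0[OF this, of i] i have "coeff q i = 0"
      by simp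
    moreover have "coeff q i = (\<Sum>l\<in>insert 0 {1..K}. if l = i then e l else 0)"
      unfolding q_def coeff_sum by (intro sum.cong) auto
    moreover have "\<dots> = e i"
      using i by (subst sum.delta) auto
    ultimately show ?thesis by simp
  qed
  show "C' = C" using e0[of 1 0] by (simp add: e_def)
  show "c' l = c l" if "l \<ge> 1" using e0[of l l] that by (simp add: e_def)
qed

theorem theorem1p14:
  fixes g h :: "complex \<Rightarrow> complex" and a :: "nat \<Rightarrow> complex" and U :: "complex set" and r :: real
  assumes g_cont: "continuous_on (cball 0 1) g"
    and g_holo: "g holomorphic_on ball 0 1"
    and r_pos: "r > 0"
    and g_series: "\<And>z. z \<in> ball 0 r \<Longrightarrow> (\<lambda>n. a n * z ^ n) sums g z"
    and U_open: "open U"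
    and U_nbhd: "closure (csqrt ` ball 1 1) \<subseteq> U"
    and h_holo: "h holomorphic_on U"
    and g_eq: "\<And>z. z \<in> cball 0 1 \<Longrightarrow> g z = h (csqrt (1 - z))"
  shows "\<exists>C c. has_three_halves_expansion a C c \<and>
           (\<forall>C' c'. has_three_halves_expansion a C' c' \<longrightarrow> C' = C \<and> (\<forall>l\<ge>1. c' l = c l)) \<and>
           C = - deriv h 0 / (2 * of_real (sqrt pi))"
proof -
  \<comment> \<open>The radius \<open>min r 1\<close> lies within both the disc where the series is
    given and the disc where \<open>g\<close> is expressed by \<open>h\<close>.\<close>
  have "(\<lambda>n. fps_nth (Abs_fps a) n * z ^ n) sums h (csqrt (1 - z))"
    if "z \<in> ball 0 (min r 1)" for z
    using g_series[of z] g_eq[of z] that by simp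
  hence "(\<lambda>z. h (csqrt (1 - z))) has_fps_expansion Abs_fps a"
    using r_pos
    by (intro has_fps_expansionI eventually_nhds_in_open[THEN eventually_mono, of "ball 0 (min r 1)"])
      auto
  from csqrt_coeff_inverse_expansion[OF this U_open U_nbhd h_holo]
  obtain c where "has_three_halves_expansion a (- deriv h 0 / (2 * of_real (sqrt pi))) c"
    using has_three_halves_expansion_ex[of _ a] by auto
  with has_three_halves_expansion_unique[OF this] show ?thesis by blast
qed

end
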